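(* Consider the ramified Cauchy problem for the complex inviscid Burgers equation $$u_t-u\,u_x=0,\qquad u(0,x)=x^{1/3},\qquad (t,x)\in\mathbb{C}^2 .$$ Then there exist holomorphic functions $a(t,x)$, $p(t,x)$, $q(t,x)$ defined in some neighbourhood of $(0,0)\in\mathbb{C}^2$ with $$a(0,x)=0,\qquad p(0,x)=0,\qquad q(0,x)=x,$$ such that $u:=a+z$ is the unique (local) solution of this Cauchy problem, where the (ramified) function $z(t,x)$ satisfies $z^3=p\,z+q$.
   Context: Time, space and the unknown $u$ are complex; $u_t,u_x$ are complex partial derivatives. Solving the ramified Cauchy problem means finding an open neighbourhood $U$ of $(0,0)\in\mathbb{C}^2$ and a germ of a holomorphic function $u$ at a point $(0,x_0)\in U$, $x_0\neq 0$, satisfying the equation and the initial condition (for a chosen branch of $x^{1/3}$ near $x_0$), such that $u$ can be continued holomorphically along any path in $U$ that does not meet a certain characteristic hypersurface which restricts to $x=0$ when $t=0$. The branch of $z$ is the one with $z(0,x)=x^{1/3}$ near $x_0$. Uniqueness refers to the germ of solution at $(0,x_0)$ for the given branch of the datum. *)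

theory Defs
  imports "HOL-Complex_Analysis.Complex_Analysis"
begin

text \<open>
  Points of the complex plane squared are pairs \<open>(t, x)\<close>. A germ of a function at a point is given
  by a total function, of which only the values near the point matter; equality of germs at \<open>y\<close>
  is \<open>\<forall>\<^sub>F y' in nhds y. f y' = g y'\<close>.
\<close>

section \<open>Holomorphic functions of two complex variables\<close>

text \<open>The derivative is required to be complex linear, not just real linear.\<close>

definition complex_differentiable2 :: "(complex \<times> complex \<Rightarrow> complex) \<Rightarrow> complex \<times> complex \<Rightarrow> bool" where
  "complex_differentiable2 f y \<longleftrightarrow>
     (\<exists>A B. (f has_derivative (\<lambda>(h, k). A * h + B * k)) (at y))"

definition holomorphic2_on :: "(complex \<times> complex \<Rightarrow> complex) \<Rightarrow> (complex \<times> complex) set \<Rightarrow> bool" where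
  "holomorphic2_on f U \<longleftrightarrow> open U \<and> (\<forall>y\<in>U. complex_differentiable2 f y)"

definition holomorphic_germ :: "(complex \<times> complex \<Rightarrow> complex) \<Rightarrow> complex \<times> complex \<Rightarrow> bool" where
  "holomorphic_germ f y \<longleftrightarrow> (\<exists>V. y \<in> V \<and> holomorphic2_on f V)"

definition partial_t :: "(complex \<times> complex \<Rightarrow> complex) \<Rightarrow> complex \<times> complex \<Rightarrow> complex" where
  "partial_t f y = deriv (\<lambda>t. f (t, snd y)) (fst y)"

definition partial_x :: "(complex \<times> complex \<Rightarrow> complex) \<Rightarrow> complex \<times> complex \<Rightarrow> complex" where
  "partial_x f y = deriv (\<lambda>x. f (fst y, x)) (snd y)"

section \<open>Analytic continuation along a path\<close>

text \<open>
  \<open>F r\<close> is the germ at \<open>\<gamma> r\<close>, for parameters \<open>r\<close> in the interval \<open>T\<close> with \<open>0 \<in> T\<close>; neighbouring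
  germs agree. The initial germ at \<open>\<gamma> 0\<close> is that of \<open>u\<close>.
\<close>

definition continuation_along ::
  "(complex \<times> complex \<Rightarrow> complex) \<Rightarrow> (real \<Rightarrow> complex \<times> complex) \<Rightarrow> real set \<Rightarrow>
   (real \<Rightarrow> complex \<times> complex \<Rightarrow> complex) \<Rightarrow> bool" where
  "continuation_along u \<gamma> T F \<longleftrightarrow>
     (\<forall>\<^sub>F y in nhds (\<gamma> 0). F 0 y = u y) \<and>
     (\<forall>r\<in>T. holomorphic_germ (F r) (\<gamma> r)) \<and>
     (\<forall>r\<in>T. \<forall>\<^sub>F r' in at r within T. \<forall>\<^sub>F y in nhds (\<gamma> r'). F r' y = F r y)"

section \<open>The ramified Cauchy problem\<close>

text \<open>
  The hypersurface is \<open>{y \<in> U. s y = 0}\<close>. The equation \<open>s\<close> is reduced: its gradient does not vanish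
  on a dense part of the hypersurface, so that the points where it does not vanish are regular
  points and the gradient is a conormal there.
\<close>

definition regular_points ::
  "(complex \<times> complex) set \<Rightarrow> (complex \<times> complex \<Rightarrow> complex) \<Rightarrow> (complex \<times> complex) set" where
  "regular_points U s = {y \<in> U. s y = 0 \<and> (partial_t s y \<noteq> 0 \<or> partial_x s y \<noteq> 0)}"

definition hypersurface_from_origin ::
  "(complex \<times> complex) set \<Rightarrow> (complex \<times> complex \<Rightarrow> complex) \<Rightarrow> bool" where
  "hypersurface_from_origin U s \<longleftrightarrow>
     holomorphic2_on s U \<and>
     {y \<in> U. s y = 0} \<subseteq> closure (regular_points U s) \<and>
     (\<forall>x. (0, x) \<in> U \<longrightarrow> (s (0, x) = 0 \<longleftrightarrow> x = 0))"

definition cbrt_branch :: "(complex \<Rightarrow> complex) \<Rightarrow> complex \<Rightarrow> bool" where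
  "cbrt_branch g x0 \<longleftrightarrow>
     (\<exists>D. open D \<and> x0 \<in> D \<and> g holomorphic_on D \<and> (\<forall>x\<in>D. g x ^ 3 = x))"

definition burgers_local_solution ::
  "complex \<Rightarrow> (complex \<Rightarrow> complex) \<Rightarrow> (complex \<times> complex \<Rightarrow> complex) \<Rightarrow> bool" where
  "burgers_local_solution x0 g u \<longleftrightarrow>
     holomorphic_germ u (0, x0) \<and>
     (\<forall>\<^sub>F y in nhds (0, x0). partial_t u y - u y * partial_x u y = 0) \<and>
     (\<forall>\<^sub>F x in nhds x0. u (0, x) = g x)"

text \<open>
  The symbol of the equation at a value \<open>w\<close> of \<open>u\<close> is \<open>\<tau> - w * \<xi>\<close>. As \<open>u\<close> is ramified along the
  hypersurface, \<open>w\<close> is the limit of a continuation of \<open>u\<close> along a path that reaches the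
  hypersurface only at its endpoint \<open>y\<close>. The other branches of \<open>u\<close> may well be unramified at \<open>y\<close>,
  and the hypersurface need not be characteristic for their values.
\<close>

definition burgers_characteristic_at ::
  "(complex \<times> complex) set \<Rightarrow> (complex \<times> complex \<Rightarrow> complex) \<Rightarrow> complex \<Rightarrow>
   (complex \<times> complex \<Rightarrow> complex) \<Rightarrow> complex \<times> complex \<Rightarrow> bool" where
  "burgers_characteristic_at U s x0 u y \<longleftrightarrow>
     (\<exists>\<gamma> F w. path \<gamma> \<and> pathstart \<gamma> = (0, x0) \<and> pathfinish \<gamma> = y \<and>
        (\<forall>r\<in>{0..<1}. \<gamma> r \<in> U \<and> s (\<gamma> r) \<noteq> 0) \<and>
        continuation_along u \<gamma> {0..<1} F \<and>
        ((\<lambda>r. F r (\<gamma> r)) \<longlongrightarrow> w) (at_left 1) \<and>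
        partial_t s y - w * partial_x s y = 0)"

definition ramified_burgers_solution ::
  "(complex \<times> complex) set \<Rightarrow> (complex \<times> complex \<Rightarrow> complex) \<Rightarrow> complex \<Rightarrow>
   (complex \<Rightarrow> complex) \<Rightarrow> (complex \<times> complex \<Rightarrow> complex) \<Rightarrow> bool" where
  "ramified_burgers_solution U s x0 g u \<longleftrightarrow>
     burgers_local_solution x0 g u \<and>
     (\<forall>\<gamma>. path \<gamma> \<and> pathstart \<gamma> = (0, x0) \<and> path_image \<gamma> \<subseteq> {y \<in> U. s y \<noteq> 0} \<longrightarrow>
        (\<exists>F. continuation_along u \<gamma> {0..1} F)) \<and>
     (\<forall>y\<in>regular_points U s. burgers_characteristic_at U s x0 u y)"

end

theory Submission
  imports Defs "HOL-Computational_Algebra.Fundamental_Theorem_Algebra"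
begin

text \<open>
  The solution is constant along the lines \<open>x + t * u = const\<close>, so \<open>u\<^sup>3 = t * u + x\<close> holds exactly, and
  \<open>a = 0\<close>, \<open>p = t\<close>, \<open>q = x\<close> work on the whole plane. The hypersurface is the zero set of the
  discriminant \<open>4 * t\<^sup>3 - 27 * x\<^sup>2\<close>. The root surface \<open>x = w\<^sup>3 - t * w\<close> is parametrised by \<open>(t, w)\<close>; its
  projection to \<open>(t, x)\<close> is a local biholomorphism at simple roots, and a three-sheeted covering off
  the hypersurface, so path lifting gives the continuations.
\<close>

section \<open>The cubic, its root surface and its local holomorphic branches\<close>

definition cubic_root :: "complex \<times> complex \<Rightarrow> complex \<Rightarrow> bool" where
  "cubic_root y w \<longleftrightarrow> w ^ 3 = fst y * w + snd y"

definition cubic_fold :: "complex \<times> complex \<Rightarrow> complex \<times> complex" where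
  "cubic_fold y = (fst y, snd y ^ 3 - fst y * snd y)"

definition cubic_disc :: "complex \<times> complex \<Rightarrow> complex" where
  "cubic_disc y = 4 * fst y ^ 3 - 27 * snd y ^ 2"

text \<open>The window \<open>W\<close> isolates one root over each point of \<open>V\<close>, so
  germs of roots can be identified just by checking that their values lie in \<open>W\<close>. The
  derivative is the one that implicit differentiation of \<open>w^3 = t * w + x\<close>
  gives.\<close>

definition root_branch ::
  "(complex \<times> complex) set \<Rightarrow> complex set \<Rightarrow> (complex \<times> complex \<Rightarrow> complex) \<Rightarrow> bool" where
  "root_branch V W Z \<longleftrightarrow> open V \<and> open W \<and>
     (\<forall>y\<in>V. Z y \<in> W \<and> cubic_root y (Z y) \<and>
        (Z has_derivative (\<lambda>(h, k). Z y / (3 * Z y ^ 2 - fst y) * h + 1 / (3 * Z y ^ 2 - fst y) * k)) (at y)) \<and>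
     (\<forall>y\<in>V. \<forall>w\<in>W. cubic_root y w \<longrightarrow> w = Z y)"

lemma cubic_root_iff_fold: "cubic_root y w \<longleftrightarrow> cubic_fold (fst y, w) = y"
  by (cases y) (auto simp: cubic_root_def cubic_fold_def algebra_simps)

lemma has_derivative_cubic_fold:
  "(cubic_fold has_derivative (\<lambda>(h, k). (h, (3 * snd y ^ 2 - fst y) * k - snd y * h))) (at y)"
  unfolding cubic_fold_def
  by (auto intro!: derivative_eq_intros simp: fun_eq_iff algebra_simps power2_eq_square)

lemma continuous_on_cubic_fold: "continuous_on S cubic_fold"
  unfolding cubic_fold_def by (intro continuous_intros)

text \<open>An inverse function argument: \<open>cubic_fold\<close> is injective on a small box
  around \<open>(t, w0)\<close>, invariance of domain makes the image of the box open, and the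
  branch is the second coordinate of the inverse. The set \<open>B\<close> allows the window to be
  shrunk at will.\<close>

lemma root_branch_exists:
  assumes root: "cubic_root y0 w0" and simple: "3 * w0 ^ 2 \<noteq> fst y0"
    and B: "open B" "w0 \<in> B"
  obtains V W Z where "root_branch V W Z" "y0 \<in> V" "w0 \<in> W" "W \<subseteq> B"
proof -
  \<comment> \<open>This is the divided difference of \<open>w^3 - t * w\<close> in
    \<open>w\<close>. On the diagonal it is \<open>3 * w^2 - t\<close>, so it is nonzero near a
    simple root; this gives both injectivity of the fold and simplicity of all roots in the
    box.\<close>
  let ?G = "\<lambda>(t, w, w'). w ^ 2 + w * w' + w' ^ 2 - t :: complex"
  have "isCont ?G (fst y0, w0, w0)"
    by (auto simp: case_prod_unfold intro!: continuous_intros)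
  then have "(?G \<longlongrightarrow> ?G (fst y0, w0, w0)) (nhds (fst y0, w0, w0))"
    unfolding isCont_def tendsto_at_iff_tendsto_nhds .
  moreover have "?G (fst y0, w0, w0) \<noteq> 0"
    using simple by (simp add: power2_eq_square algebra_simps)
  ultimately have "\<forall>\<^sub>F p in nhds (fst y0, w0, w0). ?G p \<noteq> 0"
    by (rule tendsto_imp_eventually_ne)
  then have "\<forall>\<^sub>F p in nhds (fst y0) \<times>\<^sub>F (nhds w0 \<times>\<^sub>F nhds w0). ?G p \<noteq> 0"
    by (simp add: nhds_prod)
  then obtain P Q where P: "eventually P (nhds (fst y0))" and Q: "eventually Q (nhds w0 \<times>\<^sub>F nhds w0)"
    and PQ: "\<And>t q. P t \<Longrightarrow> Q q \<Longrightarrow> ?G (t, q) \<noteq> 0"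
    unfolding eventually_prod_filter by blast
  from Q obtain Q1 Q2 where Q12: "eventually Q1 (nhds w0)" "eventually Q2 (nhds w0)"
    and Q: "\<And>w w'. Q1 w \<Longrightarrow> Q2 w' \<Longrightarrow> Q (w, w')"
    unfolding eventually_prod_filter by blast
  obtain T where T: "open T" "fst y0 \<in> T" "\<And>t. t \<in> T \<Longrightarrow> P t"
    using P by (auto simp: eventually_nhds)
  have "\<forall>\<^sub>F w in nhds w0. Q1 w \<and> Q2 w \<and> w \<in> B"
    using Q12 B by (simp add: eventually_conj eventually_nhds_in_open)
  then obtain W where W: "open W" "w0 \<in> W" "\<And>w. w \<in> W \<Longrightarrow> Q1 w \<and> Q2 w \<and> w \<in> B"
    by (auto simp: eventually_nhds)
  define N where "N = T \<times> W"
  have "open N" using T W by (simp add: N_def open_Times)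
  have G: "?G (t, w, w') \<noteq> 0" if "t \<in> T" "w \<in> W" "w' \<in> W" for t w w'
    using that T W PQ Q by blast
  have inj: "inj_on cubic_fold N"
  proof (rule inj_onI)
    fix a b assume ab: "a \<in> N" "b \<in> N" and eq: "cubic_fold a = cubic_fold b"
    obtain t w t' w' where [simp]: "a = (t, w)" "b = (t', w')" by (cases a; cases b)
    have "t' = t" using eq by (simp add: cubic_fold_def)
    have "(w - w') * ?G (t, w, w') = 0"
      using eq by (simp add: cubic_fold_def power2_eq_square power3_eq_cube algebra_simps)
    then show "a = b" using G[of t w w'] ab \<open>t' = t\<close> by (auto simp: N_def)
  qed
  define V where "V = cubic_fold ` N"
  define Z where "Z = snd \<circ> inv_into N cubic_fold"
  have "open V"
    unfolding V_def using continuous_on_cubic_fold \<open>open N\<close> inj by (rule invariance_of_domain)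
  have Z: "Z (cubic_fold n) = snd n" if "n \<in> N" for n
    using that inj by (simp add: Z_def)
  have "root_branch V W Z"
    unfolding root_branch_def
  proof (intro conjI ballI impI \<open>open V\<close> \<open>open W\<close>)
    fix y assume "y \<in> V"
    then obtain n where n: "n \<in> N" "y = cubic_fold n" by (auto simp: V_def)
    obtain t w where [simp]: "n = (t, w)" by (cases n)
    have tw: "t \<in> T" "w \<in> W" using n by (auto simp: N_def)
    have yt: "fst y = t" and yw: "Z y = w" using n Z[of n] by (auto simp: cubic_fold_def)
    show "Z y \<in> W" using tw yw by simp
    have "cubic_root y w" using n by (simp add: cubic_root_iff_fold cubic_fold_def)
    then show "cubic_root y (Z y)" by (simp add: yw)
    have d: "3 * w ^ 2 - t \<noteq> 0"
      using G[OF tw(1,2,2)] by (simp add: power2_eq_square algebra_simps)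
    \<comment> \<open>The differential of the fold is triangular with diagonal entries
      \<open>1\<close> and \<open>3 * w^2 - t\<close>, so it is inverted by solving for the second
      component.\<close>
    have "(inv_into N cubic_fold has_derivative (\<lambda>(h, k). (h, (k + w * h) / (3 * w ^ 2 - t)))) (at (cubic_fold n))"
    proof (rule has_derivative_inverse_strong[OF \<open>open N\<close> \<open>n \<in> N\<close> continuous_on_cubic_fold _ has_derivative_cubic_fold])
      show "inv_into N cubic_fold (cubic_fold m) = m" if "m \<in> N" for m
        using that inj by simp
      show "(\<lambda>(h, k). (h, (3 * snd n ^ 2 - fst n) * k - snd n * h)) \<circ>
            (\<lambda>(h, k). (h, (k + w * h) / (3 * w ^ 2 - t))) = id"
        using d by (auto simp: fun_eq_iff)
    qed
    from has_derivative_snd[OF this]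
    have "(Z has_derivative (\<lambda>(h, k). w / (3 * w ^ 2 - t) * h + 1 / (3 * w ^ 2 - t) * k)) (at (cubic_fold n))"
      by (simp add: Z_def o_def case_prod_unfold add_divide_distrib add.commute)
    then show "(Z has_derivative (\<lambda>(h, k). Z y / (3 * Z y ^ 2 - fst y) * h + 1 / (3 * Z y ^ 2 - fst y) * k)) (at y)"
      by (simp only: yt yw flip: n(2))
    fix w' assume "w' \<in> W" "cubic_root y w'"
    then show "w' = Z y"
      using Z[of "(t, w')"] tw by (auto simp: cubic_root_iff_fold N_def yt)
  qed
  moreover have "y0 \<in> V"
  proof -
    have "(fst y0, w0) \<in> N" using T W by (simp add: N_def)
    moreover have "y0 = cubic_fold (fst y0, w0)" using root by (simp add: cubic_root_iff_fold)
    ultimately show ?thesis unfolding V_def by blast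
  qed
  ultimately show thesis using that W by blast
qed

lemma root_branchD:
  assumes "root_branch V W Z"
  shows "open V" "open W"
    and "y \<in> V \<Longrightarrow> Z y \<in> W"
    and "y \<in> V \<Longrightarrow> cubic_root y (Z y)"
    and "y \<in> V \<Longrightarrow> (Z has_derivative (\<lambda>(h, k). Z y / (3 * Z y ^ 2 - fst y) * h + 1 / (3 * Z y ^ 2 - fst y) * k)) (at y)"
    and "y \<in> V \<Longrightarrow> w \<in> W \<Longrightarrow> cubic_root y w \<Longrightarrow> w = Z y"
  using assms by (auto simp: root_branch_def)

lemma root_branch_isCont: "root_branch V W Z \<Longrightarrow> y \<in> V \<Longrightarrow> isCont Z y"
  by (blast intro: has_derivative_continuous root_branchD)

lemma root_branch_holomorphic: "root_branch V W Z \<Longrightarrow> holomorphic2_on Z V"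
  unfolding holomorphic2_on_def complex_differentiable2_def
  by (blast intro: root_branchD)

text \<open>By continuity \<open>f\<close> stays in the window \<open>W\<close> near
  \<open>y0\<close>, and there \<open>Z\<close> is the only root. All later equalities of germs come
  from this.\<close>

lemma eventually_eq_root_branch:
  assumes Z: "root_branch V W Z" "y0 \<in> V" and f: "isCont f y0" "f y0 \<in> W"
    and root: "\<forall>\<^sub>F y in nhds y0. cubic_root y (f y)"
  shows "\<forall>\<^sub>F y in nhds y0. f y = Z y"
proof -
  have "(f \<longlongrightarrow> f y0) (nhds y0)"
    using f(1) unfolding isCont_def tendsto_at_iff_tendsto_nhds .
  then have "\<forall>\<^sub>F y in nhds y0. f y \<in> W"
    using f(2) root_branchD(2)[OF Z(1)] by (blast intro: topological_tendstoD)
  moreover have "\<forall>\<^sub>F y in nhds y0. y \<in> V"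
    using Z root_branchD(1) by (blast intro: eventually_nhds_in_open)
  ultimately show ?thesis
    using root by eventually_elim (blast intro: root_branchD(6)[OF Z(1)])
qed

section \<open>Partial derivatives and the Burgers equation for root branches\<close>

lemma partial_t_eq:
  assumes "(f has_derivative (\<lambda>(h, k). A * h + B * k)) (at y)"
  shows "((\<lambda>t. f (t, snd y)) has_field_derivative A) (at (fst y))" "partial_t f y = A"
proof -
  have "((\<lambda>t. (t, snd y)) has_derivative (\<lambda>h. (h, 0))) (at (fst y))"
    by (auto intro!: derivative_eq_intros)
  from has_derivative_compose[OF this, of f "\<lambda>(h, k). A * h + B * k"] assms
  show "((\<lambda>t. f (t, snd y)) has_field_derivative A) (at (fst y))"
    by (simp add: has_field_derivative_def)
  then show "partial_t f y = A" unfolding partial_t_def by (rule DERIV_imp_deriv)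
qed

lemma partial_x_eq:
  assumes "(f has_derivative (\<lambda>(h, k). A * h + B * k)) (at y)"
  shows "((\<lambda>x. f (fst y, x)) has_field_derivative B) (at (snd y))" "partial_x f y = B"
proof -
  have "((\<lambda>x. (fst y, x)) has_derivative (\<lambda>k. (0, k))) (at (snd y))"
    by (auto intro!: derivative_eq_intros)
  from has_derivative_compose[OF this, of f "\<lambda>(h, k). A * h + B * k"] assms
  show "((\<lambda>x. f (fst y, x)) has_field_derivative B) (at (snd y))"
    by (simp add: has_field_derivative_def)
  then show "partial_x f y = B" unfolding partial_x_def by (rule DERIV_imp_deriv)
qed

text \<open>The two partial derivatives share the denominator \<open>3 * Z^2 - t\<close>, and their
  numerators are \<open>Z\<close> and \<open>1\<close>.\<close>

lemma root_branch_burgers: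
  assumes "root_branch V W Z" "y \<in> V"
  shows "partial_t Z y - Z y * partial_x Z y = 0"
  using partial_t_eq(2)[OF root_branchD(5)[OF assms]] partial_x_eq(2)[OF root_branchD(5)[OF assms]]
  by simp

section \<open>Analytic continuation along paths\<close>

text \<open>A continuous choice \<open>v\<close> of simple roots along the path suffices: take at
  each \<open>r\<close> the branch through \<open>v r\<close>. The parameter set is left general
  because both closed and half-open intervals occur.\<close>

lemma continuation_along_cubic_roots:
  assumes "0 \<in> T" and cont: "continuous_on T \<gamma>" "continuous_on T v"
    and root: "\<And>r. r \<in> T \<Longrightarrow> cubic_root (\<gamma> r) (v r)"
    and simple: "\<And>r. r \<in> T \<Longrightarrow> 3 * v r ^ 2 \<noteq> fst (\<gamma> r)"
    and u: "\<forall>\<^sub>F y in nhds (\<gamma> 0). cubic_root y (u y)" "isCont u (\<gamma> 0)" "u (\<gamma> 0) = v 0"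
  obtains F where "continuation_along u \<gamma> T F" "\<And>r. r \<in> T \<Longrightarrow> F r (\<gamma> r) = v r"
proof -
  have "\<exists>Z V W. root_branch V W Z \<and> \<gamma> r \<in> V \<and> v r \<in> W" if "r \<in> T" for r
    using root_branch_exists[OF root[OF that] simple[OF that], of UNIV] by (metis UNIV_I open_UNIV)
  then obtain F V W where F: "\<And>r. r \<in> T \<Longrightarrow> root_branch (V r) (W r) (F r)"
    and V: "\<And>r. r \<in> T \<Longrightarrow> \<gamma> r \<in> V r" and W: "\<And>r. r \<in> T \<Longrightarrow> v r \<in> W r"
    by metis
  have Fv: "F r (\<gamma> r) = v r" if "r \<in> T" for r
    using root_branchD(6)[OF F V W root] that by metis
  have "continuation_along u \<gamma> T F"
    unfolding continuation_along_def
  proof (intro conjI ballI)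
    show "\<forall>\<^sub>F y in nhds (\<gamma> 0). F 0 y = u y"
      using eventually_eq_root_branch[OF F V u(2) _ u(1)] W u(3) \<open>0 \<in> T\<close>
      by (simp add: eq_commute)
    fix r assume r: "r \<in> T"
    show "holomorphic_germ (F r) (\<gamma> r)"
      unfolding holomorphic_germ_def using root_branch_holomorphic[OF F[OF r]] V[OF r] by blast
    have "\<forall>\<^sub>F r' in at r within T. \<gamma> r' \<in> V r"
      using cont(1) r V[OF r] root_branchD(1)[OF F[OF r]]
      by (auto simp: continuous_on_def intro: topological_tendstoD)
    moreover have "\<forall>\<^sub>F r' in at r within T. v r' \<in> W r"
      using cont(2) r W[OF r] root_branchD(2)[OF F[OF r]]
      by (auto simp: continuous_on_def intro: topological_tendstoD)
    moreover have "\<forall>\<^sub>F r' in at r within T. r' \<in> T"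
      by (simp add: eventually_at_filter)
    ultimately show "\<forall>\<^sub>F r' in at r within T. \<forall>\<^sub>F y in nhds (\<gamma> r'). F r' y = F r y"
    proof eventually_elim
      case (elim r')
      \<comment> \<open>Near \<open>\<gamma> r'\<close> the germ \<open>F r'\<close> is a continuous
        root whose value \<open>v r'\<close> lies in the window of \<open>F r\<close>, so the two
        branches agree there.\<close>
      have "\<forall>\<^sub>F y in nhds (\<gamma> r'). cubic_root y (F r' y)"
        using eventually_nhds_in_open[OF root_branchD(1)[OF F[OF elim(3)]] V[OF elim(3)]]
        by eventually_elim (rule root_branchD(4)[OF F[OF elim(3)]])
      then show ?case
        using eventually_eq_root_branch[OF F[OF r] elim(1) root_branch_isCont[OF F V]] elim Fv
        by simp
    qed
  qed
  then show thesis using Fv that by blast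
qed

section \<open>The discriminant and the covering by the three roots\<close>

text \<open>The discriminant is the product of the squared differences of the roots. The differences
  between \<open>w\<close> and the other two roots multiply to \<open>3 * w^2 - t\<close>, and those
  two differ by a square root of \<open>4 * t - 3 * w^2\<close>.\<close>

lemma cubic_disc_eq:
  assumes "cubic_root y w"
  shows "cubic_disc y = (3 * w ^ 2 - fst y) ^ 2 * (4 * fst y - 3 * w ^ 2)"
proof -
  have "snd y = w ^ 3 - fst y * w" using assms by (simp add: cubic_root_def)
  show ?thesis
    unfolding cubic_disc_def \<open>snd y = w ^ 3 - fst y * w\<close>
    by (simp add: power2_eq_square power3_eq_cube algebra_simps)
qed

lemma cubic_rootE:
  fixes y :: "complex \<times> complex"
  obtains w where "cubic_root y w"
proof -
  have deg: "degree [:- snd y, - fst y, 0, 1:] > 0" by simp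
  obtain w where "poly [:- snd y, - fst y, 0, 1:] w = 0"
    using alg_closed_imp_poly_has_root[OF deg] by (elim exE)
  then have "cubic_root y w"
    by (simp add: cubic_root_def power3_eq_cube algebra_simps)
  then show thesis by (rule that)
qed

lemma three_cubic_roots:
  assumes "cubic_disc y \<noteq> 0"
  obtains w1 w2 w3 where "cubic_root y w1" "cubic_root y w2" "cubic_root y w3"
    "w1 \<noteq> w2" "w1 \<noteq> w3" "w2 \<noteq> w3"
proof -
  obtain w where w: "cubic_root y w" by (rule cubic_rootE)
  \<comment> \<open>Dividing the cubic by \<open>z - w\<close> leaves
    \<open>z^2 + w * z + w^2 - t\<close>, whose discriminant is \<open>4 * t - 3 * w^2\<close>; the
    other two roots are given by the quadratic formula.\<close>
  define d where "d = csqrt (4 * fst y - 3 * w ^ 2)"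
  have d2: "d ^ 2 = 4 * fst y - 3 * w ^ 2" by (simp add: d_def)
  have disc: "3 * w ^ 2 \<noteq> fst y" "d \<noteq> 0"
    using assms d2 by (auto simp: cubic_disc_eq[OF w])
  have ne: "w \<noteq> (- w + d) / 2" if "d ^ 2 = 4 * fst y - 3 * w ^ 2" for d
  proof
    assume "w = (- w + d) / 2"
    then have "d = 3 * w" by (simp add: field_simps)
    \<comment> \<open>Now \<open>(3 * w)^2 = 4 * t - 3 * w^2\<close>, that is
      \<open>3 * w^2 = t\<close>, which would make \<open>w\<close> a multiple root.\<close>
    with that disc(1) show False by (simp add: power_mult_distrib)
  qed
  have root: "cubic_root y ((- w + d) / 2)" if "d ^ 2 = 4 * fst y - 3 * w ^ 2" for d
  proof -
    define z where "z = (- w + d) / 2"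
    have "d = 2 * z + w" by (simp add: z_def field_simps)
    then have "4 * (z ^ 2 + z * w + w ^ 2 - fst y) = 0"
      using that by (simp add: power2_eq_square algebra_simps)
    then have "z ^ 2 + z * w + w ^ 2 - fst y = 0"
      by (metis mult_eq_0_iff zero_neq_numeral)
    moreover have "z ^ 3 - fst y * z - snd y =
        (z - w) * (z ^ 2 + z * w + w ^ 2 - fst y) + (w ^ 3 - fst y * w - snd y)"
      by (simp add: power2_eq_square power3_eq_cube algebra_simps)
    moreover have "w ^ 3 - fst y * w - snd y = 0" using w by (simp add: cubic_root_def)
    ultimately have "z ^ 3 - fst y * z - snd y = 0" by (simp only: mult_zero_right add_0)
    then show ?thesis unfolding z_def[symmetric] cubic_root_def by (simp add: algebra_simps)
  qed
  have d2': "(- d) ^ 2 = 4 * fst y - 3 * w ^ 2" using d2 by simp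
  show thesis
  proof (rule that[OF w root[OF d2] root[OF d2'] ne[OF d2] ne[OF d2']])
    show "(- w + d) / 2 \<noteq> (- w + - d) / 2" using disc(2) by simp
  qed
qed

text \<open>Two distinct roots satisfy \<open>a^2 + a * b + b^2 = t\<close>; subtracting two such
  relations shows that three distinct roots sum to zero. Hence \<open>w1\<close> and
  \<open>w2\<close> determine the remaining root.\<close>

lemma cubic_root_cases:
  assumes r: "cubic_root y w1" "cubic_root y w2" "cubic_root y w3" "cubic_root y w"
    and ne: "w1 \<noteq> w2" "w1 \<noteq> w3" "w2 \<noteq> w3"
  shows "w = w1 \<or> w = w2 \<or> w = w3"
proof -
  have quad: "a ^ 2 + a * b + b ^ 2 = fst y" if "cubic_root y a" "cubic_root y b" "a \<noteq> b" for a b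
  proof -
    have "(a - b) * (a ^ 2 + a * b + b ^ 2 - fst y) =
        (a ^ 3 - fst y * a - snd y) - (b ^ 3 - fst y * b - snd y)"
      by (simp add: power2_eq_square power3_eq_cube algebra_simps)
    also have "\<dots> = 0" using that(1,2) by (simp add: cubic_root_def)
    finally show ?thesis using that(3) by simp
  qed
  have sum0: "a + b + c = 0" if "cubic_root y a" "cubic_root y b" "cubic_root y c" "a \<noteq> b" "a \<noteq> c" "b \<noteq> c"
    for a b c
  proof -
    have "(b - c) * (a + b + c) = (a ^ 2 + a * b + b ^ 2) - (a ^ 2 + a * c + c ^ 2)"
      by (simp add: power2_eq_square algebra_simps)
    also have "\<dots> = 0" using quad[of a b] quad[of a c] that by simp
    finally have "(b - c) * (a + b + c) = 0" .
    then show ?thesis using that(6) by simp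
  qed
  show ?thesis
    using sum0[of w1 w2 w3] sum0[of w1 w2 w] r ne by (metis add_left_cancel)
qed

text \<open>Over \<open>T\<close> the window \<open>W\<close> picks exactly one point of each fibre,
  namely \<open>(t, Z y)\<close>.\<close>

lemma sheet_homeomorphism:
  assumes Z: "root_branch V W Z" and "T \<subseteq> V"
  shows "homeomorphism {n. cubic_fold n \<in> T \<and> snd n \<in> W} T cubic_fold (\<lambda>y. (fst y, Z y))"
proof (rule homeomorphismI)
  show "continuous_on {n. cubic_fold n \<in> T \<and> snd n \<in> W} cubic_fold"
    by (rule continuous_on_cubic_fold)
  have "continuous_on T Z"
    using assms by (blast intro: continuous_at_imp_continuous_on root_branch_isCont)
  then show "continuous_on T (\<lambda>y. (fst y, Z y))" by (intro continuous_intros)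
  have fold: "cubic_fold (fst y, Z y) = y" if "y \<in> T" for y
    using root_branchD(4)[OF Z subsetD[OF \<open>T \<subseteq> V\<close> that]] by (simp add: cubic_root_iff_fold)
  then show "cubic_fold (fst y, Z y) = y" if "y \<in> T" for y using that .
  show "(\<lambda>y. (fst y, Z y)) ` T \<subseteq> {n. cubic_fold n \<in> T \<and> snd n \<in> W}"
    using fold root_branchD(3)[OF Z] \<open>T \<subseteq> V\<close> by auto
  show "(fst (cubic_fold n), Z (cubic_fold n)) = n" if "n \<in> {n. cubic_fold n \<in> T \<and> snd n \<in> W}" for n
  proof -
    have "snd n = Z (cubic_fold n)"
      using that root_branchD(6)[OF Z, of "cubic_fold n" "snd n"] \<open>T \<subseteq> V\<close>
      by (auto simp: cubic_root_iff_fold) (auto simp: cubic_fold_def)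
    then show ?thesis by (simp add: cubic_fold_def prod_eq_iff)
  qed
qed auto

lemma open_sheet:
  assumes "open T" "open W"
  shows "open {n. cubic_fold n \<in> T \<and> snd n \<in> W}"
proof -
  have "open (cubic_fold -` T)" "open (snd -` W :: (complex \<times> complex) set)"
    using assms continuous_on_cubic_fold[of UNIV] by (auto intro: open_vimage open_vimage_snd)
  then have "open (cubic_fold -` T \<inter> snd -` W)" by (rule open_Int)
  then show ?thesis by (simp add: vimage_def Int_def)
qed

lemma simple_of_cubic_disc:
  assumes "cubic_disc y \<noteq> 0" "cubic_root y w"
  shows "3 * w ^ 2 \<noteq> fst y"
  using assms(1) cubic_disc_eq[OF assms(2)] by auto

lemma open_cubic_disc_neq_0: "open {y. cubic_disc y \<noteq> 0}"
  unfolding cubic_disc_def by (intro open_Collect_neq continuous_intros)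

text \<open>Off the discriminant the three roots are simple. Disjoint windows around them give three
  branches over a common neighbourhood \<open>T\<close>, and the parts of the root surface in these
  windows are the sheets over \<open>T\<close>.\<close>

lemma covering_space_cubic_fold:
  "covering_space {n. cubic_disc (cubic_fold n) \<noteq> 0} cubic_fold {y. cubic_disc y \<noteq> 0}"
  (is "covering_space ?C cubic_fold ?S")
  unfolding covering_space_def
proof (intro conjI ballI)
  show "continuous_on ?C cubic_fold" by (rule continuous_on_cubic_fold)
  show "cubic_fold ` ?C = ?S"
  proof
    show "?S \<subseteq> cubic_fold ` ?C"
    proof
      fix y assume "y \<in> ?S"
      obtain w where "cubic_root y w" by (rule cubic_rootE)
      then show "y \<in> cubic_fold ` ?C"
        using \<open>y \<in> ?S\<close> by (intro image_eqI[of _ _ "(fst y, w)"]) (auto simp: cubic_root_iff_fold)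
    qed
  qed auto
  fix y0 assume y0: "y0 \<in> ?S"
  obtain w1 w2 w3 where w: "cubic_root y0 w1" "cubic_root y0 w2" "cubic_root y0 w3"
    and ne: "w1 \<noteq> w2" "w1 \<noteq> w3" "w2 \<noteq> w3"
    using y0 three_cubic_roots by blast
  obtain A1 A2 where A: "open A1" "open A2" "w1 \<in> A1" "w2 \<in> A2" "A1 \<inter> A2 = {}"
    using hausdorff[OF ne(1)] by blast
  obtain B1 B3 where B: "open B1" "open B3" "w1 \<in> B1" "w3 \<in> B3" "B1 \<inter> B3 = {}"
    using hausdorff[OF ne(2)] by blast
  obtain C2 C3 where C: "open C2" "open C3" "w2 \<in> C2" "w3 \<in> C3" "C2 \<inter> C3 = {}"
    using hausdorff[OF ne(3)] by blast
  have simple: "3 * w ^ 2 \<noteq> fst y0" if "cubic_root y0 w" for w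
    using y0 that simple_of_cubic_disc by blast
  obtain V1 W1 Z1 where 1: "root_branch V1 W1 Z1" "y0 \<in> V1" "w1 \<in> W1" "W1 \<subseteq> A1 \<inter> B1"
    using root_branch_exists[OF w(1) simple[OF w(1)], of "A1 \<inter> B1"] A B by (metis IntI open_Int)
  obtain V2 W2 Z2 where 2: "root_branch V2 W2 Z2" "y0 \<in> V2" "w2 \<in> W2" "W2 \<subseteq> A2 \<inter> C2"
    using root_branch_exists[OF w(2) simple[OF w(2)], of "A2 \<inter> C2"] A C by (metis IntI open_Int)
  obtain V3 W3 Z3 where 3: "root_branch V3 W3 Z3" "y0 \<in> V3" "w3 \<in> W3" "W3 \<subseteq> B3 \<inter> C3"
    using root_branch_exists[OF w(3) simple[OF w(3)], of "B3 \<inter> C3"] B C by (metis IntI open_Int)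
  have disj: "W1 \<inter> W2 = {}" "W1 \<inter> W3 = {}" "W2 \<inter> W3 = {}"
    using 1 2 3 A B C by blast+
  define T where "T = V1 \<inter> V2 \<inter> V3 \<inter> ?S"
  have "open T"
    using root_branchD(1) 1 2 3 open_cubic_disc_neq_0 unfolding T_def by (intro open_Int) blast+
  define sheet where "sheet W = {n. cubic_fold n \<in> T \<and> snd n \<in> W}" for W
  show "\<exists>T. y0 \<in> T \<and> openin (top_of_set ?S) T \<and>
            (\<exists>v. \<Union> v = ?C \<inter> cubic_fold -` T \<and> (\<forall>u\<in>v. openin (top_of_set ?C) u) \<and>
                 pairwise disjnt v \<and> (\<forall>u\<in>v. \<exists>q. homeomorphism u T cubic_fold q))"
  proof (rule exI[of _ T], intro conjI exI[of _ "{sheet W1, sheet W2, sheet W3}"])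
    show "y0 \<in> T" using 1 2 3 y0 by (simp add: T_def)
    show "openin (top_of_set ?S) T" using \<open>open T\<close> by (intro open_subset) (auto simp: T_def)
    show "\<Union> {sheet W1, sheet W2, sheet W3} = ?C \<inter> cubic_fold -` T"
    proof
      show "?C \<inter> cubic_fold -` T \<subseteq> \<Union> {sheet W1, sheet W2, sheet W3}"
      proof
        fix n assume n: "n \<in> ?C \<inter> cubic_fold -` T"
        let ?y = "cubic_fold n"
        have y: "?y \<in> V1" "?y \<in> V2" "?y \<in> V3" using n by (auto simp: T_def)
        have root: "cubic_root ?y (snd n)" by (simp add: cubic_root_def cubic_fold_def)
        \<comment> \<open>The windows are disjoint, so the three branches have distinct values and
          exhaust the roots over \<open>?y\<close>.\<close>
        have W: "Z1 ?y \<in> W1" "Z2 ?y \<in> W2" "Z3 ?y \<in> W3"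
          using root_branchD(3) 1(1) 2(1) 3(1) y by blast+
        then have "Z1 ?y \<noteq> Z2 ?y" "Z1 ?y \<noteq> Z3 ?y" "Z2 ?y \<noteq> Z3 ?y"
          using disj by auto
        then have "snd n = Z1 ?y \<or> snd n = Z2 ?y \<or> snd n = Z3 ?y"
          by (rule cubic_root_cases[OF root_branchD(4)[OF 1(1) y(1)] root_branchD(4)[OF 2(1) y(2)]
            root_branchD(4)[OF 3(1) y(3)] root])
        then show "n \<in> \<Union> {sheet W1, sheet W2, sheet W3}"
          using W n by (auto simp: sheet_def)
      qed
    qed (auto simp: sheet_def T_def)
    have "openin (top_of_set ?C) (sheet W)" if "open W" for W
      unfolding sheet_def using open_sheet[OF \<open>open T\<close> that]
      by (intro open_subset) (auto simp: T_def)
    then show "\<forall>u\<in>{sheet W1, sheet W2, sheet W3}. openin (top_of_set ?C) u"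
      using root_branchD(2)[OF 1(1)] root_branchD(2)[OF 2(1)] root_branchD(2)[OF 3(1)] by simp
    have "disjnt (sheet A) (sheet B) \<and> disjnt (sheet B) (sheet A)" if "A \<inter> B = {}" for A B
      using that by (auto simp: sheet_def disjnt_def)
    from this[OF disj(1)] this[OF disj(2)] this[OF disj(3)]
    show "pairwise disjnt {sheet W1, sheet W2, sheet W3}"
      by (auto simp: pairwise_insert)
    have "\<exists>q. homeomorphism (sheet W) T cubic_fold q" if "root_branch V W Z" "T \<subseteq> V" for V W Z
      using sheet_homeomorphism[OF that] by (auto simp: sheet_def)
    moreover have "T \<subseteq> V1" "T \<subseteq> V2" "T \<subseteq> V3" by (auto simp: T_def)
    ultimately show "\<forall>u\<in>{sheet W1, sheet W2, sheet W3}. \<exists>q. homeomorphism u T cubic_fold q"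
      using 1(1) 2(1) 3(1) by blast
  qed
qed

text \<open>Lift the path to the root surface, starting at the value of \<open>u\<close>. The second
  coordinate of the lift is a continuous choice of roots, simple because the path avoids the
  discriminant.\<close>

lemma cubic_root_continuation:
  assumes "path \<gamma>" "path_image \<gamma> \<subseteq> {y. cubic_disc y \<noteq> 0}"
    and u: "\<forall>\<^sub>F y in nhds (\<gamma> 0). cubic_root y (u y)" "isCont u (\<gamma> 0)"
  shows "\<exists>F. continuation_along u \<gamma> {0..1} F"
proof -
  have u0: "cubic_root (\<gamma> 0) (u (\<gamma> 0))" using u(1) by (rule eventually_nhds_x_imp_x)
  let ?n = "(fst (\<gamma> 0), u (\<gamma> 0))"
  have fold: "cubic_fold ?n = \<gamma> 0" using u0 by (simp add: cubic_root_iff_fold)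
  have "\<gamma> 0 \<in> path_image \<gamma>" by (simp add: path_image_def)
  then have "?n \<in> {n. cubic_disc (cubic_fold n) \<noteq> 0}" using fold assms(2) by auto
  then obtain h where h: "path h" "pathstart h = ?n" "\<And>r. r \<in> {0..1} \<Longrightarrow> cubic_fold (h r) = \<gamma> r"
    using covering_space_lift_path_strong[OF covering_space_cubic_fold _ assms(1,2)] fold
    by (metis pathstart_def)
  have root: "cubic_root (\<gamma> r) (snd (h r))" if "r \<in> {0..1}" for r
    using h(3)[OF that, symmetric] by (simp add: cubic_root_def cubic_fold_def)
  show ?thesis
  proof (rule continuation_along_cubic_roots[of "{0..1}" \<gamma> "\<lambda>r. snd (h r)" u])
    show "continuous_on {0..1} \<gamma>" "continuous_on {0..1} (\<lambda>r. snd (h r))"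
      using \<open>path \<gamma>\<close> \<open>path h\<close> by (auto simp: path_def intro: continuous_on_snd)
    show "cubic_root (\<gamma> r) (snd (h r))" if "r \<in> {0..1}" for r by (rule root[OF that])
    show "3 * snd (h r) ^ 2 \<noteq> fst (\<gamma> r)" if "r \<in> {0..1}" for r
    proof (rule simple_of_cubic_disc[OF _ root[OF that]])
      show "cubic_disc (\<gamma> r) \<noteq> 0"
        using that assms(2) unfolding path_image_def by blast
    qed
    show "u (\<gamma> 0) = snd (h 0)" using h(2) by (simp add: pathstart_def)
  qed (use u in auto)
qed

section \<open>The discriminant curve as a characteristic hypersurface\<close>

lemma has_derivative_cubic_disc:
  "(cubic_disc has_derivative (\<lambda>(h, k). 12 * fst y ^ 2 * h + (- 54 * snd y) * k)) (at y)"
  unfolding cubic_disc_def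
  by (auto intro!: derivative_eq_intros simp: fun_eq_iff algebra_simps)

lemma partial_cubic_disc:
  "partial_t cubic_disc y = 12 * fst y ^ 2" "partial_x cubic_disc y = - 54 * snd y"
  using partial_t_eq(2)[OF has_derivative_cubic_disc] partial_x_eq(2)[OF has_derivative_cubic_disc]
  by auto

text \<open>The gradient \<open>(12 * t^2, - 54 * x)\<close> vanishes only at the origin, the cusp
  of the curve.\<close>

lemma regular_points_cubic_disc:
  "regular_points UNIV cubic_disc = {y. cubic_disc y = 0 \<and> y \<noteq> (0, 0)}"
  by (auto simp: regular_points_def partial_cubic_disc prod_eq_iff)

text \<open>The parameter is the double root: \<open>t = 3 * w^2\<close> and
  \<open>x = w^3 - t * w = - 2 * w^3\<close>.\<close>

lemma cuspidal_cubic_param: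
  assumes "cubic_disc y = 0" "y \<noteq> (0, 0)"
  obtains w where "w \<noteq> 0" "y = (3 * w ^ 2, - 2 * w ^ 3)"
proof -
  obtain t x where [simp]: "y = (t, x)" by (cases y)
  have disc: "4 * t ^ 3 = 27 * x ^ 2" using assms(1) by (simp add: cubic_disc_def)
  have "t \<noteq> 0" "x \<noteq> 0" using disc assms(2) by auto
  \<comment> \<open>Solve \<open>x / t = - 2 * w / 3\<close> for \<open>w\<close>.\<close>
  define w where "w = - 3 * x / (2 * t)"
  have "12 * t ^ 2 * w ^ 2 = 27 * x ^ 2"
    using \<open>t \<noteq> 0\<close> by (simp add: w_def power_divide power_mult_distrib field_simps)
  also have "\<dots> = 12 * t ^ 2 * (t / 3)" using disc by (simp add: power2_eq_square power3_eq_cube mult.assoc)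
  finally have w2: "w ^ 2 = t / 3" using \<open>t \<noteq> 0\<close> by (simp add: field_simps)
  have "w ^ 3 = w * w ^ 2" by (simp add: power2_eq_square power3_eq_cube)
  also have "\<dots> = - x / 2" using \<open>t \<noteq> 0\<close> unfolding w2 by (simp add: w_def)
  finally have "y = (3 * w ^ 2, - 2 * w ^ 3)" by (simp add: w2)
  moreover have "w \<noteq> 0" using \<open>t \<noteq> 0\<close> \<open>x \<noteq> 0\<close> by (simp add: w_def)
  ultimately show thesis using that by blast
qed

lemma cuspidal_cubic_disc:
  "cubic_disc (3 * w ^ 2, - 2 * w ^ 3) = 0"
  by (simp add: cubic_disc_def power2_eq_square power3_eq_cube)

lemma hypersurface_from_origin_cubic_disc: "hypersurface_from_origin UNIV cubic_disc"
  unfolding hypersurface_from_origin_def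
proof (intro conjI allI impI)
  show "holomorphic2_on cubic_disc UNIV"
    unfolding holomorphic2_on_def complex_differentiable2_def
    using has_derivative_cubic_disc by blast
  show "cubic_disc (0, x) = 0 \<longleftrightarrow> x = 0" for x by (simp add: cubic_disc_def)
  \<comment> \<open>The cusp is approached along the parametrised curve with
    \<open>w = 1 / (n + 1)\<close>.\<close>
  have "(0, 0) \<in> closure (regular_points UNIV cubic_disc)"
    unfolding closure_sequential
  proof (intro exI conjI allI)
    let ?w = "\<lambda>n. of_real (inverse (real (Suc n))) :: complex"
    show "(3 * ?w n ^ 2, - 2 * ?w n ^ 3) \<in> regular_points UNIV cubic_disc" for n
    proof -
      have "?w n \<noteq> 0" unfolding of_real_eq_0_iff by simp
      then show ?thesis
        using cuspidal_cubic_disc[of "?w n"] unfolding regular_points_cubic_disc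
        by (simp del: of_real_inverse)
    qed
    have "(\<lambda>n. inverse (real (Suc n))) \<longlonglongrightarrow> 0" by (rule LIMSEQ_inverse_real_of_nat)
    then have "?w \<longlonglongrightarrow> of_real 0" by (rule tendsto_of_real)
    moreover have "(\<lambda>n. (3 * w n ^ 2, - 2 * w n ^ 3)) \<longlonglongrightarrow> (3 * l ^ 2, - 2 * l ^ 3)"
      if "w \<longlonglongrightarrow> l" for w and l :: complex
      by (intro tendsto_intros that)
    ultimately have "(\<lambda>n. (3 * ?w n ^ 2, - 2 * ?w n ^ 3)) \<longlonglongrightarrow> (3 * of_real 0 ^ 2, - 2 * of_real 0 ^ 3)"
      by blast
    then show "(\<lambda>n. (3 * ?w n ^ 2, - 2 * ?w n ^ 3)) \<longlonglongrightarrow> (0, 0)" by simp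
  qed
  then show "{y \<in> UNIV. cubic_disc y = 0} \<subseteq> closure (regular_points UNIV cubic_disc)"
    using closure_subset[of "regular_points UNIV cubic_disc"] by (auto simp: regular_points_cubic_disc)
qed

text \<open>Where \<open>w\<close> is the double root, the gradient is \<open>108 * w^3\<close>
  times \<open>(w, 1)\<close>, so the curve is characteristic for the value \<open>w\<close>. It
  remains to find a path to \<open>y\<close> along which the continuation of \<open>u\<close> tends
  to this double root; it is built on the root surface and projected.\<close>

lemma burgers_characteristic_at_cubic_disc:
  assumes u: "\<forall>\<^sub>F y in nhds (0, x0). cubic_root y (u y)" "isCont u (0, x0)" and "x0 \<noteq> 0"
    and y: "y \<in> regular_points UNIV cubic_disc"
  shows "burgers_characteristic_at UNIV cubic_disc x0 u y"
proof -
  obtain w where w: "w \<noteq> 0" and yw: "y = (3 * w ^ 2, - 2 * w ^ 3)"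
    using y cuspidal_cubic_param[of y] unfolding regular_points_cubic_disc by blast
  define u0 where "u0 = u (0, x0)"
  have x0: "x0 = u0 ^ 3"
    using eventually_nhds_x_imp_x[OF u(1)] by (simp add: cubic_root_def u0_def)
  have "u0 \<noteq> 0" using \<open>x0 \<noteq> 0\<close> x0 by auto
  \<comment> \<open>In the coordinates \<open>(t, w)\<close> of the root surface, the preimage of the hypersurface consists of
    the parabolas \<open>t = 3 * w\<^sup>2\<close>, where \<open>w\<close> is the double root, and \<open>4 * t = 3 * w\<^sup>2\<close>. In the path
    \<open>t = c * w\<^sup>2\<close> the ratio \<open>c\<close> goes from \<open>0\<close> to \<open>3\<close> and leaves the real line to avoid \<open>3 / 4\<close>.\<close>
  define v where "v r = exp (of_real (1 - r) * Ln u0 + of_real r * Ln w)" for r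
  define c where "c r = Complex (3 * r) (r * (1 - r))" for r
  define \<gamma> where "\<gamma> r = cubic_fold (c r * v r ^ 2, v r)" for r
  have v: "v r \<noteq> 0" "v 0 = u0" "v 1 = w" for r
    using \<open>u0 \<noteq> 0\<close> \<open>w \<noteq> 0\<close> by (auto simp: v_def)
  have c01: "c 0 = 0" "c 1 = 3" by (auto simp: c_def complex_eq_iff)
  have c: "c r \<noteq> 3" "4 * c r \<noteq> 3" if "r \<in> {0..<1}" for r
    using that by (auto simp: c_def complex_eq_iff)
  have cont_v: "continuous_on A v" for A
    unfolding v_def by (intro continuous_intros)
  have cont: "continuous_on A \<gamma>" for A
    unfolding \<gamma>_def cubic_fold_def c_def Complex_eq
    by (auto intro!: continuous_intros cont_v)
  have fst_\<gamma>: "fst (\<gamma> r) = c r * v r ^ 2" for r by (simp add: \<gamma>_def cubic_fold_def)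
  have root: "cubic_root (\<gamma> r) (v r)" for r
    by (simp add: cubic_root_def \<gamma>_def cubic_fold_def)
  have simple: "3 * v r ^ 2 \<noteq> fst (\<gamma> r)" if "r \<in> {0..<1}" for r
    using c[OF that] v(1) by (simp add: fst_\<gamma>)
  \<comment> \<open>On this path the discriminant equals
    \<open>(3 - c)^2 * (4 * c - 3) * v^6\<close>.\<close>
  have disc: "cubic_disc (\<gamma> r) \<noteq> 0" if "r \<in> {0..<1}" for r
  proof -
    have "4 * fst (\<gamma> r) - 3 * v r ^ 2 = (4 * c r - 3) * v r ^ 2"
      by (simp add: fst_\<gamma> algebra_simps)
    then show ?thesis
      using simple[OF that] c[OF that] v(1) by (simp add: cubic_disc_eq[OF root])
  qed
  have \<gamma>0: "\<gamma> 0 = (0, x0)" by (simp add: \<gamma>_def cubic_fold_def c01 v x0)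
  have \<gamma>1: "\<gamma> 1 = y"
    by (simp add: \<gamma>_def cubic_fold_def c01 v yw power2_eq_square power3_eq_cube)
  \<comment> \<open>At \<open>r = 1\<close> the root \<open>w\<close> is double, so branches are
    taken on the half-open interval only.\<close>
  obtain F where F: "continuation_along u \<gamma> {0..<1} F" "\<And>r. r \<in> {0..<1} \<Longrightarrow> F r (\<gamma> r) = v r"
    by (rule continuation_along_cubic_roots[of "{0..<1}" \<gamma> v u])
       (use cont cont_v root simple u v(2) \<gamma>0 u0_def in auto)
  show ?thesis
    unfolding burgers_characteristic_at_def
  proof (intro exI conjI)
    show "path \<gamma>" using cont by (simp add: path_def)
    show "pathstart \<gamma> = (0, x0)" "pathfinish \<gamma> = y"
      using \<gamma>0 \<gamma>1 by (auto simp: pathstart_def pathfinish_def)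
    show "\<forall>r\<in>{0..<1}. \<gamma> r \<in> UNIV \<and> cubic_disc (\<gamma> r) \<noteq> 0" using disc by blast
    show "continuation_along u \<gamma> {0..<1} F" by (rule F)
    have "(v \<longlongrightarrow> v 1) (at_left 1)"
      using cont_v[of UNIV] by (simp add: continuous_on_eq_continuous_at isCont_def filterlim_at_split)
    moreover have "\<forall>\<^sub>F r in at_left (1::real). r \<in> {0<..<1}"
      by (rule eventually_at_leftI[of 0]) auto
    then have "\<forall>\<^sub>F r in at_left 1. v r = F r (\<gamma> r)"
      by eventually_elim (use F(2) in auto)
    ultimately show "((\<lambda>r. F r (\<gamma> r)) \<longlongrightarrow> w) (at_left 1)"
      by (simp add: v Lim_transform_eventually)
    show "partial_t cubic_disc y - w * partial_x cubic_disc y = 0"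
      by (simp add: partial_cubic_disc yw power2_eq_square power3_eq_cube)
  qed
qed

section \<open>Uniqueness by the method of characteristics\<close>

text \<open>
  Along the straight line through \<open>(t, x)\<close> on which \<open>x + t * c\<close> is constant, with \<open>c = v (t, x)\<close>, the
  difference \<open>h = v - c\<close> satisfies the linear equation \<open>h' = v\<^sub>x * h\<close> and vanishes at \<open>(t, x)\<close>, so
  \<open>v = c\<close> also at the foot point \<open>(0, x + t * c)\<close>.
\<close>

lemma burgers_local_solution_cubic_root:
  assumes v: "burgers_local_solution x0 g v" and g: "cbrt_branch g x0"
  shows "\<forall>\<^sub>F y in nhds (0, x0). cubic_root y (v y)"
proof -
  obtain V1 where V1: "(0, x0) \<in> V1" "holomorphic2_on v V1"
    using v by (auto simp: burgers_local_solution_def holomorphic_germ_def)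
  have "open V1" using V1 by (simp add: holomorphic2_on_def)
  obtain D where D: "open D" "x0 \<in> D" "\<And>x. x \<in> D \<Longrightarrow> g x ^ 3 = x"
    using g by (auto simp: cbrt_branch_def)
  have "\<forall>\<^sub>F y in nhds (0, x0). y \<in> V1 \<and> partial_t v y - v y * partial_x v y = 0"
    using v V1 \<open>open V1\<close>
    by (auto simp: burgers_local_solution_def intro!: eventually_conj eventually_nhds_in_open)
  then obtain d1 where d1: "d1 > 0" "\<And>y. dist y (0, x0) < d1 \<Longrightarrow> y \<in> V1 \<and> partial_t v y - v y * partial_x v y = 0"
    unfolding eventually_nhds_metric by blast
  have "\<forall>\<^sub>F x in nhds x0. v (0, x) = g x \<and> x \<in> D"
    using v D by (auto simp: burgers_local_solution_def intro!: eventually_conj eventually_nhds_in_open)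
  then obtain d2 where d2: "d2 > 0" "\<And>x. dist x x0 < d2 \<Longrightarrow> v (0, x) = g x \<and> x \<in> D"
    unfolding eventually_nhds_metric by blast
  \<comment> \<open>Points of \<open>?K\<close> below are within \<open>3 * e < d1\<close> of
    \<open>(0, x0)\<close>. Its radius \<open>2 * e\<close> in \<open>x\<close> leaves room for
    discs of radius \<open>e\<close> around points within \<open>e\<close> of
    \<open>x0\<close>.\<close>
  define e where "e = min d1 d2 / 4"
  have "e > 0" using d1 d2 by (simp add: e_def)
  let ?K = "cball (0 :: complex) e \<times> cball x0 (2 * e)"
  have K: "y \<in> V1 \<and> partial_t v y - v y * partial_x v y = 0" if "y \<in> ?K" for y
  proof (rule d1(2))
    obtain t x where [simp]: "y = (t, x)" by (cases y)
    have "dist y (0, x0) \<le> dist t 0 + dist x x0"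
      unfolding dist_Pair_Pair \<open>y = (t, x)\<close> by (rule sqrt_sum_squares_le_sum) auto
    also have "\<dots> \<le> 3 * e" using that by (simp add: dist_commute)
    also have "\<dots> < d1" using d1(1) d2(1) by (simp add: e_def)
    finally show "dist y (0, x0) < d1" .
  qed
  have D2: "v (0, x) ^ 3 = x" if "dist x x0 \<le> e" for x
    using d2(2)[of x] D(3)[of x] that \<open>e > 0\<close> by (auto simp: e_def)
  define B where "B = partial_x v"
  \<comment> \<open>The equation gives \<open>v_t = v * v_x\<close>, so \<open>B\<close> alone
    determines the differential.\<close>
  have deriv: "(v has_derivative (\<lambda>(h, k). v y * B y * h + B y * k)) (at y)" if y: "y \<in> ?K" for y
  proof -
    obtain A' B' where AB: "(v has_derivative (\<lambda>(h, k). A' * h + B' * k)) (at y)"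
      using K[OF y] V1(2) unfolding holomorphic2_on_def complex_differentiable2_def by blast
    have "B' = B y" "A' = v y * B y"
      using partial_t_eq(2)[OF AB] partial_x_eq(2)[OF AB] K[OF y] by (auto simp: B_def)
    with AB show ?thesis by simp
  qed
  have cont: "continuous_on ?K v"
    using deriv by (blast intro: continuous_at_imp_continuous_on has_derivative_continuous)
  have "compact ?K" by (intro compact_Times compact_cball)
  then have "bounded (v ` ?K)" using cont by (blast intro: compact_imp_bounded compact_continuous_image)
  then obtain M where M: "M > 0" "\<And>y. y \<in> ?K \<Longrightarrow> norm (v y) \<le> M"
    unfolding bounded_pos by blast
  \<comment> \<open>Cauchy's estimate for the first derivative in \<open>x\<close>, on a disc of
    radius \<open>e\<close>.\<close>
  have B_le: "norm (B (t, x)) \<le> M / e" if "norm t \<le> e" "dist x x0 \<le> e" for t x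
  proof -
    have in_K: "(t, x') \<in> ?K" if "dist x x' \<le> e" for x'
      using \<open>norm t \<le> e\<close> \<open>dist x x0 \<le> e\<close> that dist_triangle[of x0 x' x] by (simp add: dist_commute)
    have der: "((\<lambda>x. v (t, x)) has_field_derivative B (t, x')) (at x')" if "dist x x' \<le> e" for x'
      using partial_x_eq(1)[OF deriv[OF in_K[OF that]]] by simp
    have "norm ((deriv ^^ 1) (\<lambda>x. v (t, x)) x) \<le> fact 1 * M / e ^ 1"
    proof (rule Cauchy_inequality)
      show "(\<lambda>x. v (t, x)) holomorphic_on ball x e"
        unfolding holomorphic_on_def field_differentiable_def
        using der by (meson has_field_derivative_at_within less_imp_le mem_ball)
      show "continuous_on (cball x e) (\<lambda>x. v (t, x))"
        using der by (auto intro!: continuous_at_imp_continuous_on DERIV_isCont)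
      show "norm (v (t, x')) \<le> M" if "norm (x - x') = e" for x'
        using that by (intro M(2) in_K) (simp add: dist_norm)
    qed (rule \<open>e > 0\<close>)
    then show ?thesis using \<open>e > 0\<close> by (simp add: B_def partial_x_def)
  qed
  \<comment> \<open>As \<open>norm c \<le> M\<close>, the bound
    \<open>\<delta> * M \<le> e / 2\<close> keeps the line within \<open>e\<close> of
    \<open>x0\<close>. It also makes \<open>\<delta> * M / e\<close> at most \<open>1 / 2\<close>,
    the contraction factor used below.\<close>
  define \<delta> where "\<delta> = min (e / 2) (e / (2 * M))"
  have \<delta>: "\<delta> > 0" "\<delta> \<le> e / 2" "\<delta> * M \<le> e / 2"
    using \<open>e > 0\<close> M(1) by (auto simp: \<delta>_def min_def field_simps)
  have main: "cubic_root (t, x) (v (t, x))" if tx: "norm t < \<delta>" "dist x x0 < \<delta>" for t x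
  proof -
    define c where "c = v (t, x)"
    have "norm c \<le> M"
      unfolding c_def using tx \<delta> by (intro M(2)) (auto simp: dist_commute)
    have line: "dist (x + (t - \<tau>) * c) x0 \<le> e" "norm \<tau> \<le> e" "norm (\<tau> - t) \<le> \<delta>"
      if "\<tau> \<in> closed_segment 0 t" for \<tau>
    proof -
      show *: "norm (\<tau> - t) \<le> \<delta>" using segment_bound(2)[OF that] tx by (simp add: norm_minus_commute)
      show "norm \<tau> \<le> e" using segment_bound(1)[OF that] tx \<delta> by simp
      have "norm ((t - \<tau>) * c) \<le> \<delta> * M"
        unfolding norm_mult using * \<open>norm c \<le> M\<close> \<delta>(1) by (intro mult_mono) (auto simp: norm_minus_commute)
      moreover have "dist (x + (t - \<tau>) * c) x0 \<le> norm ((t - \<tau>) * c) + dist x x0"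
        using norm_triangle_ineq[of "(t - \<tau>) * c" "x - x0"] by (simp add: dist_norm algebra_simps)
      ultimately show "dist (x + (t - \<tau>) * c) x0 \<le> e" using tx \<delta> by simp
    qed
    define h where "h \<tau> = v (\<tau>, x + (t - \<tau>) * c) - c" for \<tau>
    let ?b = "\<lambda>\<tau>. B (\<tau>, x + (t - \<tau>) * c)"
    have dh: "(h has_field_derivative h \<tau> * ?b \<tau>) (at \<tau>)" if "\<tau> \<in> closed_segment 0 t" for \<tau>
    proof -
      let ?y = "(\<tau>, x + (t - \<tau>) * c)"
      have "((\<lambda>\<tau>. (\<tau>, x + (t - \<tau>) * c)) has_derivative (\<lambda>s. (s, - s * c))) (at \<tau>)"
        by (auto intro!: derivative_eq_intros)
      moreover have "?y \<in> ?K" using line(1,2)[OF that] \<open>e > 0\<close> by (simp add: dist_commute)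
      ultimately have "((\<lambda>\<tau>. v (\<tau>, x + (t - \<tau>) * c)) has_derivative
          (\<lambda>s. case (s, - s * c) of (h, k) \<Rightarrow> v ?y * B ?y * h + B ?y * k)) (at \<tau>)"
        by (intro has_derivative_compose[OF _ deriv])
      then have "((\<lambda>\<tau>. v (\<tau>, x + (t - \<tau>) * c)) has_field_derivative h \<tau> * ?b \<tau>) (at \<tau>)"
        unfolding has_field_derivative_def by (rule has_derivative_eq_rhs) (auto simp: h_def fun_eq_iff algebra_simps)
      from DERIV_diff[OF this DERIV_const[of c]] show ?thesis by (simp add: h_def[abs_def])
    qed
    have "continuous_on (closed_segment 0 t) (\<lambda>\<tau>. norm (h \<tau>))"
      using dh by (intro continuous_on_norm continuous_at_imp_continuous_on) (auto intro: DERIV_isCont)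
    \<comment> \<open>In place of a uniqueness theorem for the linear equation: where
      \<open>norm h\<close> is maximal, the mean value inequality and \<open>h t = 0\<close> give
      \<open>norm (h \<sigma>) \<le> norm (h \<sigma>) / 2\<close>, so \<open>h\<close> vanishes on
      the segment.\<close>
    then obtain \<sigma> where \<sigma>: "\<sigma> \<in> closed_segment 0 t" "\<And>\<tau>. \<tau> \<in> closed_segment 0 t \<Longrightarrow> norm (h \<tau>) \<le> norm (h \<sigma>)"
      using continuous_attains_sup[OF compact_segment, of 0 t] by fastforce
    have "norm (h \<sigma> - h t) \<le> (norm (h \<sigma>) * (M / e)) * norm (\<sigma> - t)"
    proof (rule field_differentiable_bound[OF convex_closed_segment[of 0 t]])
      fix \<tau> assume \<tau>: "\<tau> \<in> closed_segment 0 t"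
      show "(h has_field_derivative h \<tau> * ?b \<tau>) (at \<tau> within closed_segment 0 t)"
        using dh[OF \<tau>] by (rule has_field_derivative_at_within)
      show "norm (h \<tau> * ?b \<tau>) \<le> norm (h \<sigma>) * (M / e)"
        unfolding norm_mult using \<sigma>(2)[OF \<tau>] B_le line[OF \<tau>] by (intro mult_mono) auto
    qed (use \<sigma> in auto)
    also have "\<dots> \<le> (norm (h \<sigma>) * (M / e)) * \<delta>"
      using line(3)[OF \<sigma>(1)] M(1) \<open>e > 0\<close> by (intro mult_left_mono) auto
    also have "\<dots> = norm (h \<sigma>) * (\<delta> * M / e)" by simp
    also have "\<dots> \<le> norm (h \<sigma>) * (1 / 2)"
      using \<delta>(3) \<open>e > 0\<close> by (intro mult_left_mono) (auto simp: field_simps)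
    finally have "norm (h \<sigma>) = 0" by (simp add: h_def c_def)
    then have "h 0 = 0" using \<sigma>(2)[of 0] by simp
    then have "v (0, x + t * c) = c" by (simp add: h_def)
    \<comment> \<open>The foot point is in the range of the initial datum, whose cube is the
      identity; this turns \<open>v = c\<close> there into the cubic for \<open>c\<close>.\<close>
    moreover have "dist (x + t * c) x0 \<le> e" using line(1)[of 0] by simp
    ultimately have "c ^ 3 = x + t * c" using D2 by metis
    then show ?thesis by (simp add: cubic_root_def c_def)
  qed
  have "\<forall>\<^sub>F y in nhds (0, x0). y \<in> ball 0 \<delta> \<times> ball x0 \<delta>"
    using \<delta>(1) by (intro eventually_nhds_in_open open_Times) auto
  then show ?thesis
    by eventually_elim (use main in \<open>auto simp: dist_commute\<close>)
qed

section \<open>Existence and uniqueness for every branch of the datum\<close>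

lemma holomorphic_germ_isCont:
  assumes "holomorphic_germ f y" shows "isCont f y"
  using assms unfolding holomorphic_germ_def holomorphic2_on_def complex_differentiable2_def
  by (blast intro: has_derivative_continuous)

lemma holomorphic2_on_linear: "holomorphic2_on (\<lambda>(t, x). A * t + B * x) UNIV"
  unfolding holomorphic2_on_def complex_differentiable2_def
proof (intro conjI ballI exI)
  fix y :: "complex \<times> complex"
  show "((\<lambda>(t, x). A * t + B * x) has_derivative (\<lambda>(h, k). A * h + B * k)) (at y)"
    by (auto simp: case_prod_unfold intro!: derivative_eq_intros)
qed auto

theorem corollary4p1:
  shows "\<exists>(U :: (complex \<times> complex) set) a p q s.
    open U \<and> (0, 0) \<in> U \<and>
    holomorphic2_on a U \<and> holomorphic2_on p U \<and> holomorphic2_on q U \<and>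
    (\<forall>x. (0, x) \<in> U \<longrightarrow> a (0, x) = 0 \<and> p (0, x) = 0 \<and> q (0, x) = x) \<and>
    hypersurface_from_origin U s \<and>
    (\<forall>x0 g. x0 \<noteq> 0 \<and> (0, x0) \<in> U \<and> cbrt_branch g x0 \<longrightarrow>
      (\<exists>z. holomorphic_germ z (0, x0) \<and>
           (\<forall>\<^sub>F y in nhds (0, x0). z y ^ 3 = p y * z y + q y) \<and>
           (\<forall>\<^sub>F x in nhds x0. z (0, x) = g x) \<and>
           ramified_burgers_solution U s x0 g (\<lambda>y. a y + z y) \<and>
           (\<forall>v. burgers_local_solution x0 g v \<longrightarrow>
                (\<forall>\<^sub>F y in nhds (0, x0). v y = a y + z y))))"
proof (rule exI[of _ UNIV], rule exI[of _ "\<lambda>_. 0"], rule exI[of _ fst], rule exI[of _ snd],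
    rule exI[of _ cubic_disc], intro conjI allI impI)
  show "holomorphic2_on (\<lambda>_. 0) UNIV" "holomorphic2_on fst UNIV" "holomorphic2_on snd UNIV"
    using holomorphic2_on_linear[of 0 0] holomorphic2_on_linear[of 1 0] holomorphic2_on_linear[of 0 1]
    by (simp_all add: case_prod_unfold)
  show "hypersurface_from_origin UNIV cubic_disc" by (rule hypersurface_from_origin_cubic_disc)
  fix x0 g assume "x0 \<noteq> 0 \<and> (0, x0) \<in> UNIV \<and> cbrt_branch g x0"
  then have "x0 \<noteq> 0" and g: "cbrt_branch g x0" by auto
  obtain D where D: "open D" "x0 \<in> D" "g holomorphic_on D" "\<And>x. x \<in> D \<Longrightarrow> g x ^ 3 = x"
    using g by (auto simp: cbrt_branch_def)
  \<comment> \<open>At \<open>t = 0\<close> simplicity of the root only needs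
    \<open>g x0 \<noteq> 0\<close>, which follows from \<open>x0 \<noteq> 0\<close>.\<close>
  have "cubic_root (0, x0) (g x0)" "3 * g x0 ^ 2 \<noteq> fst (0, x0)"
    using D(4)[OF D(2)] \<open>x0 \<noteq> 0\<close> by (auto simp: cubic_root_def)
  from root_branch_exists[OF this, of UNIV] obtain V W z
    where z: "root_branch V W z" "(0, x0) \<in> V" "g x0 \<in> W" by auto
  have V: "\<forall>\<^sub>F y in nhds (0, x0). y \<in> V"
    using root_branchD(1)[OF z(1)] z(2) by (rule eventually_nhds_in_open)
  have germ: "holomorphic_germ z (0, x0)"
    unfolding holomorphic_germ_def using root_branch_holomorphic[OF z(1)] z(2) by blast
  have root: "\<forall>\<^sub>F y in nhds (0, x0). cubic_root y (z y)"
    using V by eventually_elim (rule root_branchD(4)[OF z(1)])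
  have pde: "\<forall>\<^sub>F y in nhds (0, x0). partial_t z y - z y * partial_x z y = 0"
    using V by eventually_elim (rule root_branch_burgers[OF z(1)])
  \<comment> \<open>On \<open>t = 0\<close> both \<open>z\<close> and \<open>g\<close> are roots of
    the cubic, and near \<open>x0\<close> both have values in the window \<open>W\<close>.\<close>
  have init: "\<forall>\<^sub>F x in nhds x0. z (0, x) = g x"
  proof -
    have "isCont g x0"
      using D(1-3) continuous_on_eq_continuous_at holomorphic_on_imp_continuous_on by blast
    then have "(g \<longlongrightarrow> g x0) (nhds x0)" unfolding isCont_def tendsto_at_iff_tendsto_nhds .
    then have "\<forall>\<^sub>F x in nhds x0. g x \<in> W"
      using root_branchD(2)[OF z(1)] z(3) by (rule topological_tendstoD)
    moreover have "\<forall>\<^sub>F x in nhds x0. x \<in> D" using D by (intro eventually_nhds_in_open)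
    moreover have "\<forall>\<^sub>F x in nhds x0. x \<in> Pair 0 -` V"
      using root_branchD(1)[OF z(1)] z(2)
      by (intro eventually_nhds_in_open open_vimage continuous_intros) auto
    ultimately show ?thesis
    proof eventually_elim
      case (elim x)
      then show ?case
        using root_branchD(6)[OF z(1), of "(0, x)" "g x"] D(4)[of x] by (simp add: cubic_root_def)
    qed
  qed
  have cont: "isCont z (0, x0)" using germ by (rule holomorphic_germ_isCont)
  show "\<exists>z. holomorphic_germ z (0, x0) \<and>
           (\<forall>\<^sub>F y in nhds (0, x0). z y ^ 3 = fst y * z y + snd y) \<and>
           (\<forall>\<^sub>F x in nhds x0. z (0, x) = g x) \<and>
           ramified_burgers_solution UNIV cubic_disc x0 g (\<lambda>y. 0 + z y) \<and>
           (\<forall>v. burgers_local_solution x0 g v \<longrightarrow> (\<forall>\<^sub>F y in nhds (0, x0). v y = 0 + z y))"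
    unfolding add_0
  proof (intro exI[of _ z] conjI allI impI germ init)
    show "\<forall>\<^sub>F y in nhds (0, x0). z y ^ 3 = fst y * z y + snd y"
      using root by (simp add: cubic_root_def)
    show "ramified_burgers_solution UNIV cubic_disc x0 g z"
      unfolding ramified_burgers_solution_def
    proof (intro conjI allI impI ballI)
      show "burgers_local_solution x0 g z"
        using germ pde init by (simp add: burgers_local_solution_def)
      show "burgers_characteristic_at UNIV cubic_disc x0 z y"
        if "y \<in> regular_points UNIV cubic_disc" for y
        using root cont \<open>x0 \<noteq> 0\<close> that by (rule burgers_characteristic_at_cubic_disc)
      fix \<gamma> assume "path \<gamma> \<and> pathstart \<gamma> = (0, x0) \<and> path_image \<gamma> \<subseteq> {y \<in> UNIV. cubic_disc y \<noteq> 0}"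
      then show "\<exists>F. continuation_along z \<gamma> {0..1} F"
        using root cont by (intro cubic_root_continuation) (auto simp: pathstart_def)
    qed
    fix v assume v: "burgers_local_solution x0 g v"
    \<comment> \<open>Any solution is a continuous root with value \<open>g x0\<close> at
      \<open>(0, x0)\<close>, so the window forces it to agree with \<open>z\<close>.\<close>
    have "isCont v (0, x0)"
      using v by (intro holomorphic_germ_isCont) (simp add: burgers_local_solution_def)
    moreover have "v (0, x0) \<in> W"
      using v z(3) by (auto simp: burgers_local_solution_def dest: eventually_nhds_x_imp_x)
    ultimately show "\<forall>\<^sub>F y in nhds (0, x0). v y = z y"
      using burgers_local_solution_cubic_root[OF v g] by (intro eventually_eq_root_branch[OF z(1,2)])
  qed
qed auto

end
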